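(* For any even integer $n\geq 2$ and any integer $p$ with $1\leq p\leq n/2$, there exists a bicriteria skew-symmetric affine vector variational inequality $(\mathrm{P}_p)$ with $n$ variables and $p$ linear constraints (that is, there exist skew-symmetric matrices $M_1,M_2\in\mathbb{R}^{n\times n}$, vectors $q_1,q_2\in\mathbb{R}^n$, and $A\in\mathbb{R}^{p\times n}$, $b\in\mathbb{R}^p$ with $K=\{x\in\mathbb{R}^n: Ax\geq b\}\neq\emptyset$, defining the problem with $F_i(x)=M_ix+q_i$, $i=1,2$, and constraint set $K$) such that $$\chi(\mathrm{Sol}(\mathrm{P}_p))=\chi(\mathrm{Sol}^w(\mathrm{P}_p))=\frac{n}{2}+p+1.$$
   Context: An affine vector variational inequality with $n$ variables, $m$ criteria and $p$ linear constraints is given by a nonempty polyhedral convex set $K=\{x\in\mathbb{R}^n: Ax\geq b\}$ with $A\in\mathbb{R}^{p\times n}$, $b\in\mathbb{R}^p$ (inequality componentwise), and affine operators $F_i(x)=M_ix+q_i$, $i=1,\dots,m$, with $M_i\in\mathbb{R}^{n\times n}$, $q_i\in\mathbb{R}^n$. For $x\in K$, $u\in\mathbb{R}^n$ put $F(x)(u)=(\langle F_1(x),u\rangle,\dots,\langle F_m(x),u\rangle)\in\mathbb{R}^m$, and let $C=\mathbb{R}^m_+$ be the nonnegative orthant. For such a problem $(\mathrm{P})$, the Pareto solution set $\mathrm{Sol}(\mathrm{P})$ is the set of $x\in K$ such that $F(x)(x-y)\notin C\setminus\{0\}$ for all $y\in K$. The weak Pareto solution set $\mathrm{Sol}^w(\mathrm{P})$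 is the set of $x\in K$ such that $F(x)(x-y)\notin \mathrm{int}\,C$ for all $y\in K$. The problem is bicriteria if $m=2$ and skew-symmetric if $M_i^T=-M_i$ for all $i$. For a topological space $S$ (here a subset of $\mathbb{R}^n$ with the induced topology), $\chi(S)$ denotes the number of connected components of $S$. *)

theory Defs
  imports "HOL-Analysis.Analysis"
begin

text \<open>An affine vector variational inequality is given by data \<open>M\<close>, \<open>q\<close> (one pair per criterion,
  the criteria being indexed by a finite type \<open>'m\<close>) and \<open>A\<close>, \<open>b\<close> (the constraints). The order on
  \<open>real ^ 'k\<close> is the componentwise one.\<close>

definition constraint_set :: "real ^ 'n ^ 'p \<Rightarrow> real ^ 'p \<Rightarrow> (real ^ 'n) set" where
  "constraint_set A b = {x. b \<le> A *v x}"

definition nonneg_orthant :: "(real ^ 'm) set" where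
  "nonneg_orthant = {c. 0 \<le> c}"

definition affine_op :: "real ^ 'n ^ 'n \<Rightarrow> real ^ 'n \<Rightarrow> real ^ 'n \<Rightarrow> real ^ 'n" where
  "affine_op M q x = M *v x + q"

definition vector_op ::
    "('m \<Rightarrow> real ^ 'n ^ 'n) \<Rightarrow> ('m \<Rightarrow> real ^ 'n) \<Rightarrow> real ^ 'n \<Rightarrow> real ^ 'n \<Rightarrow> real ^ 'm" where
  "vector_op M q x u = (\<chi> i. affine_op (M i) (q i) x \<bullet> u)"

definition pareto_sol ::
    "('m::finite \<Rightarrow> real ^ 'n ^ 'n) \<Rightarrow> ('m \<Rightarrow> real ^ 'n) \<Rightarrow> real ^ 'n ^ 'p \<Rightarrow> real ^ 'p
      \<Rightarrow> (real ^ 'n) set" where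
  "pareto_sol M q A b =
    {x \<in> constraint_set A b. \<forall>y \<in> constraint_set A b.
      vector_op M q x (x - y) \<notin> nonneg_orthant - {0}}"

definition weak_pareto_sol ::
    "('m::finite \<Rightarrow> real ^ 'n ^ 'n) \<Rightarrow> ('m \<Rightarrow> real ^ 'n) \<Rightarrow> real ^ 'n ^ 'p \<Rightarrow> real ^ 'p
      \<Rightarrow> (real ^ 'n) set" where
  "weak_pareto_sol M q A b =
    {x \<in> constraint_set A b. \<forall>y \<in> constraint_set A b.
      vector_op M q x (x - y) \<notin> interior nonneg_orthant}"

definition skew_symmetric :: "real ^ 'n ^ 'n \<Rightarrow> bool" where
  "skew_symmetric M \<longleftrightarrow> transpose M = - M"

end

theory Submission
  imports Defs
begin

text \<open>Split the space into \<open>N = n/2\<close> planes with coordinates \<open>(u\<^sub>i, v\<^sub>i)\<close>, and let the convex combination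
  of the two operators with parameter \<open>t\<close> be \<open>((t - \<tau>\<^sub>i) v\<^sub>i + 1, - (t - \<tau>\<^sub>i) u\<^sub>i)\<close> on the \<open>i\<close>-th plane, with
  distinct \<open>\<tau>\<^sub>i\<close> in \<open>(0, 1)\<close>; the \<open>p\<close> constraints are \<open>u\<^sub>i \<ge> - 1\<close> for \<open>i < p\<close>. By scalarization the weak
  Pareto set is the union over \<open>t \<in> [0, 1]\<close>, and the Pareto set the union over \<open>t \<in> (0, 1)\<close>, of the
  solution sets of these scalar variational inequalities. For \<open>t\<close> off the \<open>\<tau>\<^sub>i\<close> the only solution is
  \<open>u = 0\<close>, \<open>v\<^sub>i = - 1 / (t - \<tau>\<^sub>i)\<close>; this curve blows up at each \<open>\<tau>\<^sub>i\<close> and so falls into \<open>N + 1\<close> arcs. At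
  \<open>t = \<tau>\<^sub>i\<close> the \<open>i\<close>-th plane contributes the boundary line \<open>u\<^sub>i = - 1\<close> if \<open>i < p\<close>, and there is no
  solution otherwise. The \<open>p\<close> lines stay at distance at least 1 from the arcs and from each other.\<close>

section \<open>Counting components by a partition into relatively open pieces\<close>

text \<open>Within \<open>S\<close>, one \<open>U k\<close> and the union of the others form a
  separation, so a connected subset of \<open>S\<close> meeting \<open>U k\<close> cannot leave it.
  Each connected piece is therefore maximal. The \<open>U k\<close> may overlap outside
  \<open>S\<close>.\<close>

lemma components_open_partition:
  fixes S :: "'a::topological_space set"
  assumes cover: "S \<subseteq> (\<Union>k\<in>A. U k)"
    and op: "\<And>k. k \<in> A \<Longrightarrow> open (U k)"
    and disj: "\<And>j k. j \<in> A \<Longrightarrow> k \<in> A \<Longrightarrow> j \<noteq> k \<Longrightarrow> S \<inter> U j \<inter> U k = {}"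
    and conn: "\<And>k. k \<in> A \<Longrightarrow> connected (S \<inter> U k)"
    and ne: "\<And>k. k \<in> A \<Longrightarrow> S \<inter> U k \<noteq> {}"
  shows "components S = (\<lambda>k. S \<inter> U k) ` A" and "card (components S) = card A"
proof -
  have absorb: "D \<subseteq> S \<inter> U k" if D: "connected D" "D \<subseteq> S" "D \<inter> U k \<noteq> {}" and k: "k \<in> A" for D k
  proof -
    let ?V = "\<Union>j\<in>A - {k}. U j"
    have "open (U k)" "open ?V" using op k by auto
    moreover have "U k \<inter> ?V \<inter> D = {}" using disj k D(2) by blast
    moreover have "D \<subseteq> U k \<union> ?V" using cover D(2) by blast
    ultimately have "U k \<inter> D = {} \<or> ?V \<inter> D = {}"
      by (intro connectedD[OF D(1)])
    then have "?V \<inter> D = {}" using D(3) by (simp add: Int_commute)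
    then show ?thesis using \<open>D \<subseteq> U k \<union> ?V\<close> D(2) by blast
  qed
  show eq: "components S = (\<lambda>k. S \<inter> U k) ` A"
  proof (intro equalityI subsetI)
    fix C assume C: "C \<in> components S"
    then have C': "C \<noteq> {}" "C \<subseteq> S" "connected C"
      by (simp_all add: in_components_maximal)
    then obtain x k where "x \<in> C" "k \<in> A" "x \<in> U k" using cover by blast
    then have "C \<subseteq> S \<inter> U k" using absorb[OF C'(3,2)] by blast
    then have "C = S \<inter> U k"
      using C conn[OF \<open>k \<in> A\<close>] ne[OF \<open>k \<in> A\<close>] unfolding in_components_maximal by blast
    then show "C \<in> (\<lambda>k. S \<inter> U k) ` A" using \<open>k \<in> A\<close> by blast
  next
    fix C assume "C \<in> (\<lambda>k. S \<inter> U k) ` A"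
    then obtain k where k: "k \<in> A" "C = S \<inter> U k" by blast
    have "D = C" if "C \<subseteq> D" "D \<subseteq> S" "connected D" for D
      using absorb[OF that(3,2) _ k(1)] that(1) ne[OF k(1)] k(2) by blast
    then show "C \<in> components S"
      unfolding in_components_maximal using k conn ne by blast
  qed
  have "inj_on (\<lambda>k. S \<inter> U k) A"
    unfolding inj_on_def using disj ne by blast
  then show "card (components S) = card A"
    unfolding eq by (rule card_image)
qed

section \<open>Scalarization of bicriteria problems\<close>

lemma interior_nonneg_orthant:
  "interior (nonneg_orthant :: (real ^ 'm) set) = {c. \<forall>i. 0 < c $ i}"
proof (rule interior_unique)
  show "{c. \<forall>i. 0 < c $ i} \<subseteq> (nonneg_orthant :: (real ^ 'm) set)"
    by (auto simp: nonneg_orthant_def less_eq_vec_def less_imp_le)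
  show "open {c :: real ^ 'm. \<forall>i. 0 < c $ i}"
  proof -
    have "{c :: real ^ 'm. \<forall>i. 0 < c $ i} = (\<Inter>i. {c. 0 < c $ i})" by auto
    moreover have "open \<dots>"
      by (intro open_INT ballI open_Collect_less continuous_intros) simp
    ultimately show ?thesis by simp
  qed
  fix T :: "(real ^ 'm) set" assume T: "T \<subseteq> nonneg_orthant" "open T"
  have "T \<subseteq> {c. c $ i > 0}" for i
  proof -
    have "T \<subseteq> {c. c $ i \<ge> 0}"
      using T(1) by (auto simp: nonneg_orthant_def less_eq_vec_def)
    then have "T \<subseteq> interior {c. c $ i \<ge> 0}" using T(2) interior_maximal by blast
    then show ?thesis by simp
  qed
  then show "T \<subseteq> {c. \<forall>i. 0 < c $ i}" by blast
qed

lemma convex_constraint_set: "convex (constraint_set A b)"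
proof -
  have "constraint_set A b = (\<Inter>i. {x. (A $ i) \<bullet> x \<ge> b $ i})"
    by (auto simp: constraint_set_def less_eq_vec_def matrix_vector_mul_component)
  then show ?thesis by (simp add: convex_INT convex_halfspace_ge)
qed

definition scalarized_sol ::
    "(2 \<Rightarrow> real ^ 'n ^ 'n) \<Rightarrow> (2 \<Rightarrow> real ^ 'n) \<Rightarrow> real ^ 'n ^ 'p \<Rightarrow> real ^ 'p \<Rightarrow> real \<Rightarrow> (real ^ 'n) set" where
  "scalarized_sol M q A b t = {x \<in> constraint_set A b. \<forall>y \<in> constraint_set A b.
    ((1 - t) *\<^sub>R affine_op (M 1) (q 1) x + t *\<^sub>R affine_op (M 2) (q 2) x) \<bullet> (x - y) \<le> 0}"

lemma weak_pareto_sol_iff: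
  fixes M :: "2 \<Rightarrow> real ^ 'n ^ 'n"
  shows "x \<in> weak_pareto_sol M q A b \<longleftrightarrow> x \<in> constraint_set A b \<and>
    (\<forall>y \<in> constraint_set A b. \<not> (0 < affine_op (M 1) (q 1) x \<bullet> (x - y) \<and> 0 < affine_op (M 2) (q 2) x \<bullet> (x - y)))"
  by (auto simp: weak_pareto_sol_def interior_nonneg_orthant vector_op_def forall_2)

lemma pareto_sol_iff:
  fixes M :: "2 \<Rightarrow> real ^ 'n ^ 'n"
  shows "x \<in> pareto_sol M q A b \<longleftrightarrow> x \<in> constraint_set A b \<and>
    (\<forall>y \<in> constraint_set A b. \<not> (0 \<le> affine_op (M 1) (q 1) x \<bullet> (x - y) \<and> 0 \<le> affine_op (M 2) (q 2) x \<bullet> (x - y)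
      \<and> (0 < affine_op (M 1) (q 1) x \<bullet> (x - y) \<or> 0 < affine_op (M 2) (q 2) x \<bullet> (x - y))))"
  by (auto simp: pareto_sol_def nonneg_orthant_def vector_op_def less_eq_vec_def vec_eq_iff forall_2 less_le)

lemma pareto_sol_subset_weak:
  fixes M :: "2 \<Rightarrow> real ^ 'n ^ 'n"
  shows "pareto_sol M q A b \<subseteq> weak_pareto_sol M q A b"
  unfolding pareto_sol_iff weak_pareto_sol_iff subset_iff using less_imp_le by blast

text \<open>With both weights positive, a nonnegative pair with a positive entry has positive
  weighted sum. A zero weight would lose this, so the endpoints are treated separately
  later.\<close>

lemma scalarized_subset_pareto:
  fixes M :: "2 \<Rightarrow> real ^ 'n ^ 'n"
  assumes "0 < t" "t < 1"
  shows "scalarized_sol M q A b t \<subseteq> pareto_sol M q A b"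
proof
  fix x assume x: "x \<in> scalarized_sol M q A b t"
  have "\<not> (0 \<le> f \<and> 0 \<le> g \<and> (0 < f \<or> 0 < g))" if "(1 - t) * f + t * g \<le> 0" for f g :: real
    using that assms
    by (smt (verit) mult_nonneg_nonneg mult_pos_pos)
  with x show "x \<in> pareto_sol M q A b"
    by (auto simp: scalarized_sol_def pareto_sol_iff inner_add_left)
qed

text \<open>Weak optimality of \<open>x\<close> says that the convex set of pairs
  \<open>(f \<bullet> (x - y), g \<bullet> (x - y))\<close> misses the open positive quadrant. The
  normal of a separating line, scaled to coordinate sum 1, supplies the weights.\<close>

lemma weak_pareto_eq_Union_scalarized:
  fixes M :: "2 \<Rightarrow> real ^ 'n ^ 'n"
  shows "weak_pareto_sol M q A b = (\<Union>t\<in>{0..1}. scalarized_sol M q A b t)"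
proof (intro equalityI subsetI)
  fix x assume "x \<in> (\<Union>t\<in>{0..1}. scalarized_sol M q A b t)"
  then obtain t where t: "0 \<le> t" "t \<le> 1" and x: "x \<in> scalarized_sol M q A b t" by auto
  have "\<not> (0 < f \<and> 0 < g)" if "(1 - t) * f + t * g \<le> 0" for f g :: real
    using that t
    by (smt (verit) mult_nonneg_nonneg mult_pos_pos)
  with x show "x \<in> weak_pareto_sol M q A b"
    by (auto simp: scalarized_sol_def weak_pareto_sol_iff inner_add_left)
next
  let ?K = "constraint_set A b"
  fix x assume x: "x \<in> weak_pareto_sol M q A b"
  define f g where "f = affine_op (M 1) (q 1) x" and "g = affine_op (M 2) (q 2) x"
  have xK: "x \<in> ?K" and no: "\<And>y. y \<in> ?K \<Longrightarrow> \<not> (0 < f \<bullet> (x - y) \<and> 0 < g \<bullet> (x - y))"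
    using x by (auto simp: weak_pareto_sol_iff f_def g_def)
  let ?W = "(\<lambda>y. (f \<bullet> (x - y), g \<bullet> (x - y))) ` ?K"
  let ?Q = "{0<..} \<times> {0<..} :: (real \<times> real) set"
  have cW: "convex ?W"
  proof -
    have "linear (\<lambda>y. (f \<bullet> y, g \<bullet> y))"
      by (auto intro!: linearI simp: inner_add_right)
    then have "convex ((\<lambda>y. (f \<bullet> y, g \<bullet> y)) ` ((\<lambda>y. x - y) ` ?K))"
    proof (rule convex_linear_image)
      have "(\<lambda>y. x - y) ` ?K = (\<Union>a\<in>{x}. \<Union>y\<in>?K. {a - y})" by auto
      then show "convex ((\<lambda>y. x - y) ` ?K)"
        using convex_differences[OF convex_singleton convex_constraint_set] by metis
    qed
    then show ?thesis by (simp add: image_image)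
  qed
  have "convex ?Q" by (intro convex_Times) auto
  moreover have "?W \<inter> ?Q = {}" using no by auto
  moreover have "?W \<noteq> {}" "?Q \<noteq> {}" using xK by (auto intro: gt_ex)
  ultimately have "\<exists>a c. a \<noteq> 0 \<and> (\<forall>w\<in>?W. a \<bullet> w \<le> c) \<and> (\<forall>w\<in>?Q. c \<le> a \<bullet> w)"
    by (intro separating_hyperplane_sets cW)
  then obtain a c where ac: "a \<noteq> 0" "\<And>w. w \<in> ?W \<Longrightarrow> a \<bullet> w \<le> c" "\<And>w. w \<in> ?Q \<Longrightarrow> c \<le> a \<bullet> w"
    by blast
  obtain r s where a: "a = (r, s)" by force
  have W: "r * (f \<bullet> (x - y)) + s * (g \<bullet> (x - y)) \<le> c" if "y \<in> ?K" for y
    using ac(2) that by (auto simp: a)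
  have Q: "c \<le> r * d + s * e" if "0 < d" "0 < e" for d e
    using ac(3)[of "(d, e)"] that by (auto simp: a)
  have c0: "0 \<le> c" using W[OF xK] by simp
  \<comment> \<open>If \<open>r < 0\<close>, going far out along the first axis makes the functional
    negative on the quadrant: at the chosen point its value is \<open>s - \<bar>s\<bar> - 1\<close>,
    below \<open>0 \<le> c\<close>.\<close>
  have "0 \<le> r"
  proof (rule ccontr)
    assume "\<not> 0 \<le> r"
    then show False
      using Q[of "(\<bar>s\<bar> + 1) / (- r)" 1] c0 divide_pos_neg[of "\<bar>s\<bar> + 1" r] by auto
  qed
  moreover have "0 \<le> s"
  proof (rule ccontr)
    assume "\<not> 0 \<le> s"
    then show False
      using Q[of 1 "(\<bar>r\<bar> + 1) / (- s)"] c0 divide_pos_neg[of "\<bar>r\<bar> + 1" s] by auto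
  qed
  moreover have "r + s \<noteq> 0" using calculation ac(1) a by (auto simp: zero_prod_def)
  ultimately have rs: "0 \<le> r" "0 \<le> s" "0 < r + s" by auto
  have "c \<le> 0"
  proof (rule ccontr)
    assume "\<not> c \<le> 0"
    \<comment> \<open>This diagonal point of the quadrant is chosen so that the functional takes the
      value \<open>c / 2\<close> there.\<close>
    then have "c \<le> (r + s) * (c / (2 * (r + s)))"
      using Q[of "c / (2 * (r + s))" "c / (2 * (r + s))"] rs unfolding distrib_right[of r s] by simp
    also have "z * (c / (2 * z)) = c / 2" if "0 < z" for z using that by simp
    then have "(r + s) * (c / (2 * (r + s))) = c / 2" using rs(3) .
    finally show False using \<open>\<not> c \<le> 0\<close> by simp
  qed
  define t where "t = s / (r + s)"
  have t: "0 \<le> t" "t \<le> 1" "1 - t = r / (r + s)" using rs by (auto simp: t_def field_simps)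
  have "(1 - t) * (f \<bullet> (x - y)) + t * (g \<bullet> (x - y)) \<le> 0" if "y \<in> ?K" for y
  proof -
    have "(1 - t) * (f \<bullet> (x - y)) + t * (g \<bullet> (x - y)) = (r * (f \<bullet> (x - y)) + s * (g \<bullet> (x - y))) / (r + s)"
      unfolding t(3) by (simp add: t_def add_divide_distrib)
    also have "\<dots> \<le> 0" using W[OF that] \<open>c \<le> 0\<close> rs by (simp add: divide_nonpos_pos)
    finally show ?thesis .
  qed
  then have "x \<in> scalarized_sol M q A b t"
    using xK by (auto simp: scalarized_sol_def f_def g_def inner_add_left)
  then show "x \<in> (\<Union>t\<in>{0..1}. scalarized_sol M q A b t)" using t by auto
qed

section \<open>The problem on \<open>N\<close> coordinate planes\<close>

text \<open>The index types are known only by cardinality, so bijections name their elements: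
  \<open>\<beta>\<close> gives the plane of a coordinate and a flag, \<open>False\<close> for
  \<open>u\<close> and \<open>True\<close> for \<open>v\<close>; \<open>\<gamma>\<close> numbers the
  constraints.\<close>

locale paired_problem =
  fixes N p :: nat and \<beta> :: "'n::finite \<Rightarrow> nat \<times> bool" and \<gamma> :: "'p::finite \<Rightarrow> nat"
  assumes \<beta>: "bij_betw \<beta> UNIV ({..<N} \<times> UNIV)"
    and \<gamma>: "bij_betw \<gamma> UNIV {..<p}"
    and pos: "0 < N" and le: "p \<le> N"
begin

definition u :: "nat \<Rightarrow> 'n" where "u i = inv \<beta> (i, False)"
definition v :: "nat \<Rightarrow> 'n" where "v i = inv \<beta> (i, True)"

lemma \<beta>_u [simp]: "i < N \<Longrightarrow> \<beta> (u i) = (i, False)"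
  and \<beta>_v [simp]: "i < N \<Longrightarrow> \<beta> (v i) = (i, True)"
  using \<beta> by (auto simp: u_def v_def bij_betw_def intro!: f_inv_into_f)

lemma uv_cases: obtains i where "i < N" "j = u i" | i where "i < N" "j = v i"
proof -
  obtain i s where js: "\<beta> j = (i, s)" by force
  have "i < N" using \<beta> js by (metis SigmaD1 UNIV_I bij_betwE lessThan_iff)
  moreover have "j = inv \<beta> (i, s)" using \<beta> js by (metis bij_betw_imp_inj_on inv_f_f)
  ultimately show thesis using that by (cases s) (auto simp: u_def v_def)
qed

lemma uv_eq_iff [simp]:
  "i < N \<Longrightarrow> j < N \<Longrightarrow> u i = u j \<longleftrightarrow> i = j"
  "i < N \<Longrightarrow> j < N \<Longrightarrow> v i = v j \<longleftrightarrow> i = j"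
  "i < N \<Longrightarrow> j < N \<Longrightarrow> u i \<noteq> v j"
  "i < N \<Longrightarrow> j < N \<Longrightarrow> v i \<noteq> u j"
  by (metis \<beta>_u \<beta>_v prod.inject)+

lemma sum_uv: "(\<Sum>j\<in>UNIV. f j) = (\<Sum>i<N. f (u i) + f (v i :: 'n))" for f :: "'n \<Rightarrow> real"
proof -
  have "(\<Sum>j\<in>UNIV. f j) = (\<Sum>j\<in>UNIV. f (inv \<beta> (\<beta> j)))"
    using \<beta> by (simp add: bij_betw_imp_inj_on)
  also have "\<dots> = (\<Sum>k\<in>{..<N} \<times> UNIV. f (inv \<beta> k))"
    by (rule sum.reindex_bij_betw[OF \<beta>])
  also have "\<dots> = (\<Sum>i<N. \<Sum>s\<in>UNIV. f (inv \<beta> (i, s)))"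
    by (simp add: sum.cartesian_product)
  finally show ?thesis by (simp add: u_def v_def UNIV_bool add.commute)
qed

text \<open>Equally spaced critical parameters. The offset by 1 keeps those with
  \<open>i < N\<close> away from the endpoints 0 and 1.\<close>

definition \<tau> :: "nat \<Rightarrow> real" where "\<tau> i = real (i + 1) / real (N + 1)"

lemma \<tau>_less_iff [simp]: "\<tau> i < \<tau> j \<longleftrightarrow> i < j"
  and \<tau>_eq_iff [simp]: "\<tau> i = \<tau> j \<longleftrightarrow> i = j"
  and \<tau>_pos: "0 < \<tau> i"
  and \<tau>_less_1: "i < N \<Longrightarrow> \<tau> i < 1"
  by (auto simp: \<tau>_def divide_less_cancel)

text \<open>Block diagonal: on plane \<open>i\<close> it is \<open>c - \<tau> i\<close> times the
  generator of rotations, hence skew-symmetric. Being affine in \<open>c\<close>, the family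
  contains every convex combination of its members at 0 and 1, the two criteria.\<close>

definition mat_of :: "real \<Rightarrow> real ^ 'n ^ 'n" where
  "mat_of c = (\<chi> j k. if fst (\<beta> j) = fst (\<beta> k) \<and> snd (\<beta> j) \<noteq> snd (\<beta> k)
    then (if snd (\<beta> j) then \<tau> (fst (\<beta> j)) - c else c - \<tau> (fst (\<beta> j))) else 0)"

definition shift :: "real ^ 'n" where "shift = (\<chi> j. if snd (\<beta> j) then 0 else 1)"

definition F :: "real \<Rightarrow> real ^ 'n \<Rightarrow> real ^ 'n" where
  "F c = affine_op (mat_of c) shift"

lemma skew_symmetric_mat_of: "skew_symmetric (mat_of c)"
  by (auto simp: skew_symmetric_def transpose_def mat_of_def vec_eq_iff)

lemma F_u: "i < N \<Longrightarrow> F c x $ u i = (c - \<tau> i) * x $ v i + 1"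
  and F_v: "i < N \<Longrightarrow> F c x $ v i = - (c - \<tau> i) * x $ u i"
  by (simp_all add: F_def affine_op_def mat_of_def shift_def matrix_vector_mult_def sum_uv
      if_distrib[of "\<lambda>z. z * _"] sum.delta cong: if_cong)

lemma F_convex_combination: "(1 - t) *\<^sub>R F 0 x + t *\<^sub>R F 1 x = F t x"
proof -
  have "((1 - t) *\<^sub>R F 0 x + t *\<^sub>R F 1 x) $ j = F t x $ j" for j
    by (rule uv_cases[of j]) (auto simp: F_u F_v algebra_simps)
  then show ?thesis by (simp add: vec_eq_iff)
qed

definition Mop :: "2 \<Rightarrow> real ^ 'n ^ 'n" where "Mop i = (if i = 1 then mat_of 0 else mat_of 1)"

definition A :: "real ^ 'n ^ 'p" where "A = (\<chi> r k. if k = u (\<gamma> r) then 1 else 0)"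

definition K :: "(real ^ 'n) set" where "K = constraint_set A (\<chi> r. - 1)"

lemma mem_K: "x \<in> K \<longleftrightarrow> (\<forall>i<p. - 1 \<le> x $ u i)"
proof -
  have "(A *v x) $ r = x $ u (\<gamma> r)" for r
    by (simp add: A_def matrix_vector_mult_def if_distrib[of "\<lambda>z. z * _"] cong: if_cong)
  then have "x \<in> K \<longleftrightarrow> (\<forall>r\<in>UNIV. - 1 \<le> x $ u (\<gamma> r))"
    by (simp add: K_def constraint_set_def less_eq_vec_def)
  also have "\<dots> \<longleftrightarrow> (\<forall>i\<in>range \<gamma>. - 1 \<le> x $ u i)" by blast
  also have "range \<gamma> = {..<p}" using \<gamma> by (simp add: bij_betw_def)
  finally show ?thesis by (simp add: Ball_def)
qed

section \<open>Solving the scalar variational inequalities\<close>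

text \<open>The solution set in closed form. The conjunct \<open>i < p\<close> empties it at
  \<open>\<tau> i\<close> for \<open>p \<le> i < N\<close>: there the \<open>u i\<close> component
  of the operator is constantly 1 while \<open>u i\<close> is unbounded below on
  \<open>K\<close>.\<close>

definition S :: "real \<Rightarrow> (real ^ 'n) set" where
  "S t = {x. \<forall>i<N. if t = \<tau> i then i < p \<and> x $ u i = - 1
                   else x $ u i = 0 \<and> (t - \<tau> i) * x $ v i = - 1}"

lemma S_subset_K: "S t \<subseteq> K"
proof
  fix x assume x: "x \<in> S t"
  have "- 1 \<le> x $ u i" if "i < p" for i
  proof -
    have "i < N" using that le by simp
    then show ?thesis using x by (cases "t = \<tau> i") (auto simp: S_def)
  qed
  then show "x \<in> K" by (simp add: mem_K)
qed

text \<open>The inner product splits over the planes. On a regular plane the operator vanishes; on a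
  critical one it is \<open>(1, 0)\<close>, and \<open>x\<close> already has the least feasible
  \<open>u i\<close>.\<close>

lemma S_vi:
  assumes x: "x \<in> S t" and y: "y \<in> K"
  shows "F t x \<bullet> (x - y) \<le> 0"
proof -
  have "F t x \<bullet> (x - y) = (\<Sum>i<N. F t x $ u i * (x $ u i - y $ u i) + F t x $ v i * (x $ v i - y $ v i))"
    by (simp add: inner_vec_def sum_uv)
  also have "\<dots> \<le> 0"
  proof (intro sum_nonpos)
    fix i assume "i \<in> {..<N}"
    then have i: "i < N" by simp
    show "F t x $ u i * (x $ u i - y $ u i) + F t x $ v i * (x $ v i - y $ v i) \<le> 0"
    proof (cases "t = \<tau> i")
      case True
      then have "i < p" "x $ u i = - 1" using x i by (auto simp: S_def)
      then show ?thesis using y i True by (auto simp: F_u F_v mem_K)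
    next
      case False
      then have "x $ u i = 0" "(t - \<tau> i) * x $ v i = - 1" using x i by (auto simp: S_def)
      then show ?thesis using i by (simp add: F_u F_v)
    qed
  qed
  finally show ?thesis .
qed

text \<open>Only competitors differing from \<open>x\<close> in one coordinate are tested. Moves
  along \<open>v i\<close> are always feasible both ways, moves up along \<open>u i\<close> always,
  and moves down when there is no constraint or enough room.\<close>

lemma vi_S:
  assumes x: "x \<in> K" and vi: "\<And>y. y \<in> K \<Longrightarrow> F t x \<bullet> (x - y) \<le> 0"
  shows "x \<in> S t"
proof -
  have dir: "0 \<le> d * F t x $ k" if "x + axis k d \<in> K" for k d
    using vi[OF that] by (simp add: inner_axis mult.commute)
  have "if t = \<tau> i then i < p \<and> x $ u i = - 1 else x $ u i = 0 \<and> (t - \<tau> i) * x $ v i = - 1" if i: "i < N" for i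
  proof -
    have ax: "axis k d $ j = (if j = k then d else 0)" for k j :: 'n and d :: real
      by (simp add: axis_def)
    have "x + axis (v i) d \<in> K" for d
      using x i le by (auto simp: mem_K ax)
    from dir[OF this, of 1] dir[OF this, of "- 1"] have Fv: "F t x $ v i = 0" by simp
    have "x + axis (u i) 1 \<in> K"
      using x by (force simp: mem_K ax)
    from dir[OF this] have Fu: "0 \<le> F t x $ u i" by simp
    have down: "F t x $ u i \<le> 0" if "p \<le> i \<or> 0 \<le> x $ u i"
    proof -
      have "x + axis (u i) (- 1) \<in> K"
        using x i le that by (auto simp: mem_K ax)
      from dir[OF this] show ?thesis by simp
    qed
    show ?thesis
    proof (cases "t = \<tau> i")
      case True
      then have Fu1: "F t x $ u i = 1" using i by (simp add: F_u)
      then have ip: "i < p" using down by force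
      \<comment> \<open>This competitor has \<open>u i\<close> coordinate exactly
        \<open>- 1\<close>, the boundary value.\<close>
      have "x + axis (u i) (- (x $ u i + 1)) \<in> K"
        using x i le by (auto simp: mem_K ax)
      from dir[OF this] have "x $ u i \<le> - 1" by (simp add: Fu1)
      then show ?thesis using True ip x by (force simp: mem_K)
    next
      case False
      then have "x $ u i = 0" using Fv i by (simp add: F_v)
      moreover from this have "F t x $ u i = 0" using Fu down by simp
      ultimately show ?thesis using False i by (simp add: F_u)
    qed
  qed
  then show ?thesis by (simp add: S_def)
qed

lemma scalarized_sol_eq_S: "scalarized_sol Mop (\<lambda>i. shift) A (\<chi> r. - 1) t = S t"
proof -
  have "(1 - t) *\<^sub>R affine_op (Mop 1) shift x + t *\<^sub>R affine_op (Mop 2) shift x = F t x" for x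
    using F_convex_combination[of t x] by (simp add: F_def Mop_def)
  then have "scalarized_sol Mop (\<lambda>i. shift) A (\<chi> r. - 1) t = {x \<in> K. \<forall>y\<in>K. F t x \<bullet> (x - y) \<le> 0}"
    by (simp only: scalarized_sol_def K_def)
  also have "\<dots> = S t"
  proof (intro equalityI subsetI)
    fix x assume "x \<in> S t"
    then show "x \<in> {x \<in> K. \<forall>y\<in>K. F t x \<bullet> (x - y) \<le> 0}"
      using S_subset_K[of t] S_vi[of x t] by simp (metis subsetD)
  next
    fix x assume "x \<in> {x \<in> K. \<forall>y\<in>K. F t x \<bullet> (x - y) \<le> 0}"
    then show "x \<in> S t" by (intro vi_S) simp_all
  qed
  finally show ?thesis .
qed

lemma weak_pareto_eq: "weak_pareto_sol Mop (\<lambda>i. shift) A (\<chi> r. - 1) = (\<Union>t\<in>{0..1}. S t)"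
  by (simp add: weak_pareto_eq_Union_scalarized scalarized_sol_eq_S)

text \<open>For \<open>t \<in> {0, 1}\<close> the operator \<open>F t\<close> vanishes at the unique point of \<open>S t\<close>, where the other
  criterion can be strictly improved.\<close>

lemma endpoint_not_pareto:
  assumes x: "x \<in> S t" and t: "t = 0 \<or> t = 1"
  shows "x \<notin> pareto_sol Mop (\<lambda>i. shift) A (\<chi> r. - 1)"
proof -
  have ne: "t \<noteq> \<tau> i" if "i < N" for i
    using t \<tau>_pos[of i] \<tau>_less_1[OF that] by auto
  have uv: "x $ u i = 0" "(t - \<tau> i) * x $ v i = - 1" if "i < N" for i
    using x ne[OF that] that by (auto simp: S_def)
  have "F t x $ j = 0" for j
    by (rule uv_cases[of j]) (auto simp: F_u F_v uv)
  then have Ft: "F t x = 0" by (simp add: vec_eq_iff)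
  \<comment> \<open>Since \<open>x $ u 0 = 0\<close>, a unit step down just reaches the constraint
    boundary.\<close>
  define y where "y = x + axis (u 0) (- 1)"
  have "y \<in> K"
    using uv(1) le by (auto simp: mem_K y_def axis_def)
  \<comment> \<open>As \<open>t\<close> is 0 or 1, \<open>F (1 - t)\<close> is the other
    criterion.\<close>
  have pos': "0 < F (1 - t) x $ u 0"
    using t
  proof
    assume t0: "t = 0"
    have "x $ v 0 = 1 / \<tau> 0" using uv(2)[OF pos] t0 \<tau>_pos[of 0] by (simp add: field_simps)
    then have "F (1 - t) x $ u 0 = 1 / \<tau> 0" using \<tau>_pos[of 0] pos t0 by (simp add: F_u field_simps)
    then show ?thesis using \<tau>_pos[of 0] by simp
  next
    assume t1: "t = 1"
    have "x $ v 0 = - 1 / (1 - \<tau> 0)" using uv(2)[OF pos] t1 \<tau>_less_1[OF pos] by (simp add: field_simps)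
    moreover have "F (1 - t) x $ u 0 = - x $ v 0" using uv(2)[OF pos] pos t1 by (simp add: F_u algebra_simps)
    ultimately show ?thesis using \<tau>_less_1[OF pos] by simp
  qed
  have "0 < F (1 - t) x \<bullet> (x - y)"
    using pos' by (simp add: y_def inner_axis)
  moreover have "F t x \<bullet> (x - y) = 0" using Ft by simp
  ultimately show ?thesis
    using \<open>y \<in> K\<close> t unfolding pareto_sol_iff Mop_def F_def K_def by fastforce
qed

lemma pareto_eq: "pareto_sol Mop (\<lambda>i. shift) A (\<chi> r. - 1) = (\<Union>t\<in>{0<..<1}. S t)"
proof (intro equalityI subsetI)
  fix x assume x: "x \<in> pareto_sol Mop (\<lambda>i. shift) A (\<chi> r. - 1)"
  then have "x \<in> (\<Union>t\<in>{0..1}. S t)" using pareto_sol_subset_weak weak_pareto_eq by blast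
  then obtain t where t: "0 \<le> t" "t \<le> 1" "x \<in> S t" by auto
  then have "t \<noteq> 0" "t \<noteq> 1" using endpoint_not_pareto x by blast+
  then show "x \<in> (\<Union>t\<in>{0<..<1}. S t)" using t by auto
next
  fix x assume "x \<in> (\<Union>t\<in>{0<..<1}. S t)"
  then show "x \<in> pareto_sol Mop (\<lambda>i. shift) A (\<chi> r. - 1)"
    using scalarized_subset_pareto[of _ Mop "\<lambda>i. shift" A "\<chi> r. - 1"] by (force simp: scalarized_sol_eq_S)
qed

section \<open>Arcs and lines of the solution set\<close>

definition curve :: "real \<Rightarrow> real ^ 'n" where
  "curve t = (\<chi> j. if snd (\<beta> j) then - 1 / (t - \<tau> (fst (\<beta> j))) else 0)"

text \<open>For \<open>k \<le> N\<close>, the open interval from \<open>\<tau> (k - 1)\<close> to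
  \<open>\<tau> k\<close>, unbounded below for \<open>k = 0\<close> and above for
  \<open>k = N\<close>.\<close>

definition gap :: "nat \<Rightarrow> real set" where
  "gap k = {t. \<forall>i<N. if i < k then \<tau> i < t else t < \<tau> i}"

lemma S_regular:
  assumes "\<And>i. i < N \<Longrightarrow> t \<noteq> \<tau> i"
  shows "S t = {curve t}"
proof (intro equalityI subsetI)
  fix x assume "x \<in> S t"
  then have "x $ u i = 0" "(t - \<tau> i) * x $ v i = - 1" if "i < N" for i
    using that assms by (auto simp: S_def)
  then have uv: "x $ u i = 0" "x $ v i = - 1 / (t - \<tau> i)" if "i < N" for i
    using that assms[OF that] by (auto simp: field_simps)
  have "x $ j = curve t $ j" for j
    by (rule uv_cases[of j]) (auto simp: curve_def uv)
  then show "x \<in> {curve t}" by (simp add: vec_eq_iff)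
next
  fix x assume "x \<in> {curve t}"
  then show "x \<in> S t" using assms by (simp add: S_def curve_def)
qed

lemma convex_S: "convex (S t)"
proof -
  have coord: "convex {x :: real ^ 'n. c * x $ k = d}" for c d k
    using convex_hyperplane[of "axis k c" d] by (simp add: inner_axis')
  have "convex {x. if t = \<tau> i then i < p \<and> x $ u i = - 1 else x $ u i = 0 \<and> (t - \<tau> i) * x $ v i = - 1}" for i
    using coord[of 1 "u i" "- 1"] convex_Int[OF coord[of 1 "u i" 0] coord[of "t - \<tau> i" "v i" "- 1"]]
    by (cases "t = \<tau> i"; cases "i < p") (simp_all add: Int_def)
  moreover have "S t = (\<Inter>i\<in>{..<N}.
      {x. if t = \<tau> i then i < p \<and> x $ u i = - 1 else x $ u i = 0 \<and> (t - \<tau> i) * x $ v i = - 1})"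
    unfolding S_def by blast
  ultimately show ?thesis by (simp add: convex_INT)
qed

lemma S_line_nonempty:
  assumes "i < p"
  shows "S (\<tau> i) \<noteq> {}"
proof -
  \<comment> \<open>At \<open>v i\<close> the division by zero yields 0, which is harmless: that
    coordinate is free on the line.\<close>
  have "(\<chi> j. if snd (\<beta> j) then - 1 / (\<tau> i - \<tau> (fst (\<beta> j))) else if fst (\<beta> j) = i then - 1 else 0) \<in> S (\<tau> i)"
    using assms by (simp add: S_def)
  then show ?thesis by blast
qed

lemma connected_curve_gap:
  assumes "convex T"
  shows "connected (curve ` (T \<inter> gap k))"
proof (rule connected_continuous_image)
  have "gap k = (\<Inter>i\<in>{..<N}. if i < k then {\<tau> i<..} else {..<\<tau> i})"
    by (auto simp: gap_def split: if_splits)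
  moreover have "convex \<dots>" by (intro convex_INT) auto
  ultimately show "connected (T \<inter> gap k)" using assms by (simp add: convex_Int convex_connected)
  have "t \<noteq> \<tau> (fst (\<beta> j))" if "t \<in> gap k" for t j
  proof -
    have "fst (\<beta> j) < N" by (rule uv_cases[of j]) auto
    then show ?thesis using that by (auto simp: gap_def split: if_splits)
  qed
  then have "continuous_on (T \<inter> gap k) (\<lambda>t. if snd (\<beta> j) then - 1 / (t - \<tau> (fst (\<beta> j))) else 0)" for j
    by (cases "snd (\<beta> j)") (auto intro!: continuous_intros)
  then show "continuous_on (T \<inter> gap k) curve"
    unfolding curve_def by (rule continuous_on_vec_lambda)
qed

lemma gap_nonempty:
  assumes "k \<le> N"
  shows "{0<..<1} \<inter> gap k \<noteq> {}"
proof -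
  \<comment> \<open>The midpoint of \<open>k / (N + 1)\<close> and
    \<open>(k + 1) / (N + 1) = \<tau> k\<close>.\<close>
  let ?t = "(real k + 1 / 2) / (real N + 1)"
  have "?t \<in> {0<..<1}" using assms by (auto simp: field_simps)
  moreover have "?t \<in> gap k"
    unfolding gap_def \<tau>_def of_nat_add of_nat_1 by (auto intro!: divide_strict_right_mono)
  ultimately show ?thesis by blast
qed

lemma gap_cover:
  assumes "\<And>i. i < N \<Longrightarrow> t \<noteq> \<tau> i"
  obtains k where "k \<le> N" "t \<in> gap k"
proof -
  \<comment> \<open>The first critical parameter beyond \<open>t\<close>, with \<open>N\<close> as
    sentinel when there is none.\<close>
  define k where "k = (LEAST i. i = N \<or> t < \<tau> i)"
  have k: "k = N \<or> t < \<tau> k" unfolding k_def by (rule LeastI[of _ N]) simp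
  have "k \<le> N" unfolding k_def by (rule Least_le) simp
  have "\<tau> i < t" if "i < k" "i < N" for i
    using not_less_Least[OF that(1)[unfolded k_def]] assms[OF that(2)] by simp
  moreover have "t < \<tau> i" if "\<not> i < k" "i < N" for i
  proof -
    have "t < \<tau> k" using k that by auto
    moreover have "\<tau> k \<le> \<tau> i" using that \<tau>_less_iff[of i k] by linarith
    ultimately show ?thesis by simp
  qed
  ultimately have "t \<in> gap k" by (simp add: gap_def)
  with \<open>k \<le> N\<close> show thesis by (rule that)
qed

section \<open>Separating neighbourhoods and the component count\<close>

text \<open>\<open>Inl k\<close> is for the arc over \<open>gap k\<close>, recognized by the signs
  of the \<open>v i\<close>; \<open>Inr i\<close> is for the line at \<open>\<tau> i\<close>. The
  threshold \<open>- 1 / 2\<close> lies midway between \<open>u i = 0\<close> on the arcs and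
  \<open>u i = - 1\<close> on that line.\<close>

fun U :: "nat + nat \<Rightarrow> (real ^ 'n) set" where
  "U (Inl k) = (\<Inter>i\<in>{..<N}. {x. - 1 / 2 < x $ u i} \<inter> (if i < k then {x. x $ v i < 0} else {x. 0 < x $ v i}))"
| "U (Inr i) = {x. x $ u i < - 1 / 2}"

lemma open_U: "open (U s)"
proof (cases s)
  case (Inl k)
  then show ?thesis
    by (auto intro!: open_INT open_Int open_Collect_less continuous_intros)
next
  case (Inr i)
  then show ?thesis by (auto intro!: open_Collect_less continuous_intros)
qed

lemma S_in_U_Inr:
  assumes "x \<in> S t" "i < p"
  shows "x \<in> U (Inr i) \<longleftrightarrow> t = \<tau> i"
proof -
  have "i < N" using assms le by simp
  then show ?thesis using assms by (cases "t = \<tau> i") (auto simp: S_def)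
qed

text \<open>Off \<open>\<tau> i\<close>, \<open>v i\<close> and \<open>t - \<tau> i\<close> have
  opposite signs; at \<open>\<tau> i\<close>, the bound on \<open>u i\<close> fails. Membership thus
  depends on \<open>t\<close> alone, reducing disjointness to the parameter line.\<close>

lemma S_in_U_Inl:
  assumes x: "x \<in> S t"
  shows "x \<in> U (Inl k) \<longleftrightarrow> t \<in> gap k"
proof -
  have "- 1 / 2 < x $ u i \<and> (if i < k then x $ v i < 0 else 0 < x $ v i) \<longleftrightarrow> (if i < k then \<tau> i < t else t < \<tau> i)"
    if "i < N" for i
  proof (cases "t = \<tau> i")
    case True
    then have "x $ u i = - 1" using x that by (auto simp: S_def)
    then show ?thesis using True by auto
  next
    case False
    then have *: "x $ u i = 0" "(t - \<tau> i) * x $ v i = - 1" using x that by (auto simp: S_def)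
    then have "x $ v i < 0 \<longleftrightarrow> \<tau> i < t" "0 < x $ v i \<longleftrightarrow> t < \<tau> i"
      by (smt (verit) mult_nonneg_nonneg mult_nonpos_nonpos)+
    then show ?thesis using *(1) by auto
  qed
  then have "(\<forall>i<N. - 1 / 2 < x $ u i \<and> (if i < k then x $ v i < 0 else 0 < x $ v i)) \<longleftrightarrow> t \<in> gap k"
    by (simp add: gap_def)
  moreover have "x \<in> U (Inl k) \<longleftrightarrow> (\<forall>i<N. - 1 / 2 < x $ u i \<and> (if i < k then x $ v i < 0 else 0 < x $ v i))"
    by auto
  ultimately show ?thesis by simp
qed

lemma gap_regular: "t \<in> gap k \<Longrightarrow> i < N \<Longrightarrow> t \<noteq> \<tau> i"
  by (auto simp: gap_def split: if_splits)

lemma gap_unique: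
  assumes "t \<in> gap j" "t \<in> gap k" "j \<le> N" "k \<le> N"
  shows "j = k"
proof -
  have False if "t \<in> gap a" "t \<in> gap b" "a < b" "b \<le> N" for a b
  proof -
    have "a < N" using that by simp
    then have "t < \<tau> a" "\<tau> a < t" using that by (force simp: gap_def)+
    then show False by simp
  qed
  then show ?thesis using assms by (metis linorder_neqE_nat)
qed

text \<open>Leaving \<open>T\<close> open serves both the closed interval (weak Pareto) and the open
  one (Pareto). Convexity keeps each \<open>T \<inter> gap k\<close> connected; containing the open
  unit interval makes \<open>T\<close> meet every gap and include every \<open>\<tau> i\<close> with
  \<open>i < N\<close>. The \<open>N + 1\<close> arcs and \<open>p\<close> lines are then the
  components.\<close>

lemma card_components_S:
  assumes T: "convex T" "{0<..<1} \<subseteq> T"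
  shows "card (components (\<Union>t\<in>T. S t)) = N + p + 1"
proof -
  let ?X = "\<Union>t\<in>T. S t"
  let ?I = "{..N} <+> {..<p}"
  have arc: "?X \<inter> U (Inl k) = curve ` (T \<inter> gap k)" for k
  proof -
    have "?X \<inter> U (Inl k) = (\<Union>t\<in>T \<inter> gap k. S t)" using S_in_U_Inl by blast
    also have "\<dots> = curve ` (T \<inter> gap k)" using S_regular gap_regular by fastforce
    finally show ?thesis .
  qed
  have line: "?X \<inter> U (Inr i) = S (\<tau> i)" if "i < p" for i
  proof -
    have "\<tau> i \<in> T" using T(2) \<tau>_pos[of i] \<tau>_less_1[of i] that le by force
    then show ?thesis using S_in_U_Inr that by blast
  qed
  have "card (components ?X) = card ?I"
  proof (rule components_open_partition(2))
    show "?X \<subseteq> (\<Union>s\<in>?I. U s)"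
    proof
      fix x assume "x \<in> ?X"
      then obtain t where t: "t \<in> T" "x \<in> S t" by blast
      show "x \<in> (\<Union>s\<in>?I. U s)"
      proof (cases "\<exists>i<N. t = \<tau> i")
        case True
        then obtain i where "i < N" "t = \<tau> i" by blast
        moreover from this have "i < p" using t by (auto simp: S_def)
        ultimately have "x \<in> U (Inr i)" "Inr i \<in> ?I" using S_in_U_Inr t by auto
        then show ?thesis by blast
      next
        case False
        then obtain k where "k \<le> N" "t \<in> gap k" using gap_cover by blast
        then have "x \<in> U (Inl k)" "Inl k \<in> ?I" using S_in_U_Inl t by auto
        then show ?thesis by blast
      qed
    qed
    show "?X \<inter> U r \<inter> U s = {}" if rs: "r \<in> ?I" "s \<in> ?I" "r \<noteq> s" for r s
    proof -
      have False if x: "x \<in> S t" "x \<in> U r" "x \<in> U s" for x t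
        using rs(1,2)
      proof (elim PlusE)
        fix j k assume "r = Inl j" "s = Inl k" "j \<in> {..N}" "k \<in> {..N}"
        then show False using x rs(3) S_in_U_Inl gap_unique by (metis atMost_iff)
      next
        fix j k assume "r = Inl j" "s = Inr k" "k \<in> {..<p}"
        then show False using x le S_in_U_Inl S_in_U_Inr gap_regular
          by (metis lessThan_iff order_less_le_trans)
      next
        fix j k assume "r = Inr j" "s = Inl k" "j \<in> {..<p}"
        then show False using x le S_in_U_Inl S_in_U_Inr gap_regular
          by (metis lessThan_iff order_less_le_trans)
      next
        fix j k assume "r = Inr j" "s = Inr k" "j \<in> {..<p}" "k \<in> {..<p}"
        then show False using x rs(3) S_in_U_Inr by (metis lessThan_iff \<tau>_eq_iff)
      qed
      then show ?thesis by blast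
    qed
    show "connected (?X \<inter> U s)" if "s \<in> ?I" for s
      using that
    proof
      fix k assume "s = Inl k"
      then show ?thesis using arc connected_curve_gap[OF T(1)] by simp
    next
      fix i assume "s = Inr i" "i \<in> {..<p}"
      then show ?thesis using line convex_S convex_connected by (metis lessThan_iff)
    qed
    show "?X \<inter> U s \<noteq> {}" if "s \<in> ?I" for s
      using that
    proof
      fix k assume "s = Inl k" "k \<in> {..N}"
      then show ?thesis using arc gap_nonempty[of k] T(2) by auto
    next
      fix i assume "s = Inr i" "i \<in> {..<p}"
      then show ?thesis using line S_line_nonempty by (metis lessThan_iff)
    qed
  qed (rule open_U)
  also have "\<dots> = N + p + 1" by (simp add: card_Plus)
  finally show ?thesis .
qed

end

theorem theorem3p3:
  fixes n p :: nat
  assumes "even n" and "n \<ge> 2" and "1 \<le> p" and "p \<le> n div 2"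
    and "CARD('n::finite) = n" and "CARD('p::finite) = p"
  shows "\<exists>(M :: 2 \<Rightarrow> real ^ 'n ^ 'n) (q :: 2 \<Rightarrow> real ^ 'n) (A :: real ^ 'n ^ 'p) (b :: real ^ 'p).
    (\<forall>i. skew_symmetric (M i)) \<and>
    constraint_set A b \<noteq> {} \<and>
    card (components (pareto_sol M q A b)) = n div 2 + p + 1 \<and>
    card (components (weak_pareto_sol M q A b)) = n div 2 + p + 1"
proof -
  have "card (UNIV :: 'n set) = card ({..<n div 2} \<times> (UNIV :: bool set))"
    using assms by (simp add: card_cartesian_product)
  then obtain \<beta> :: "'n \<Rightarrow> nat \<times> bool" where \<beta>: "bij_betw \<beta> UNIV ({..<n div 2} \<times> UNIV)"
    using finite_same_card_bij[of "UNIV :: 'n set" "{..<n div 2} \<times> (UNIV :: bool set)"] by auto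
  obtain \<gamma> :: "'p \<Rightarrow> nat" where \<gamma>: "bij_betw \<gamma> UNIV {..<p}"
    using finite_same_card_bij[of "UNIV :: 'p set" "{..<p}"] assms by auto
  interpret paired_problem "n div 2" p \<beta> \<gamma>
    using \<beta> \<gamma> assms by unfold_locales auto
  have "\<forall>i. skew_symmetric (Mop i)" by (simp add: Mop_def skew_symmetric_mat_of)
  moreover have "0 \<in> constraint_set A (\<chi> r. - 1)" using mem_K[of 0] by (simp add: K_def)
  moreover have "card (components (pareto_sol Mop (\<lambda>i. shift) A (\<chi> r. - 1))) = n div 2 + p + 1"
    unfolding pareto_eq by (rule card_components_S) auto
  moreover have "card (components (weak_pareto_sol Mop (\<lambda>i. shift) A (\<chi> r. - 1))) = n div 2 + p + 1"
    unfolding weak_pareto_eq by (rule card_components_S) auto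
  ultimately show ?thesis by blast
qed

end
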